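(* There is no positive integer $n$ such that $M(n)$ is a real reduced multiring.
   Context: For a positive integer $n$, $\mathbb Z_n=\mathbb Z/n\mathbb Z$, $\mathbb Z_n^\times$ is its group of units, and $S_n=\{u^2:u\in\mathbb Z_n^\times\}$. $M(n)$ denotes the Marshall quotient of $\mathbb Z_n$ by $S_n$: the underlying set is the quotient of $\mathbb Z_n$ by the equivalence relation $a\sim b\iff as=bt$ for some $s,t\in S_n$; the class of $a$ is written $[a]$. The operations are $[a][b]=[ab]$, $-[a]=[-a]$, and the multivalued addition $[a]+[b]=\{[c]: cr=as+bt\text{ for some }r,s,t\in S_n\}$, with zero $[0]$ and unit $[1]$; with these $M(n)$ is a commutative multiring. A multiring $A$ (with multivalued addition $+$, so that $a+b$ is a subset of $A$) is real reduced if for all $a,b,c,d\in A$: (i) $1\ne 0$; (ii) $a^3=a$; (iii) $c\in a+ab^2$ implies $c=a$; (iv) if $c,d\in a^2+b^2$, then $c=d$. *)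

theory Defs
  imports "HOL-Algebra.IntRing"
begin

section \<open>Multirings\<close>

record 'a multiring = "'a monoid" +
  mzero :: "'a"
  mneg :: "'a \<Rightarrow> 'a"
  madd :: "'a \<Rightarrow> 'a \<Rightarrow> 'a set" (infixl \<open>\<boxplus>\<index>\<close> 65)

text \<open>
  Marshall's axioms for a commutative multiring: \<open>(+, -, 0)\<close> is a commutative multigroup,
  multiplication is a commutative monoid, \<open>0\<close> is absorbing, and \<open>d(a + b) \<subseteq> da + db\<close>.
  Sums are not required to be nonempty, since this follows from the axioms.
\<close>

locale comm_multiring = comm_monoid A for A :: "('a, 'b) multiring_scheme" (structure) +
  assumes mzero_closed: "mzero A \<in> carrier A"
    and mneg_closed: "a \<in> carrier A \<Longrightarrow> mneg A a \<in> carrier A"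
    and madd_closed: "\<lbrakk>a \<in> carrier A; b \<in> carrier A\<rbrakk> \<Longrightarrow> a \<boxplus> b \<subseteq> carrier A"
    and madd_reversible:
      "\<lbrakk>a \<in> carrier A; b \<in> carrier A; c \<in> a \<boxplus> b\<rbrakk> \<Longrightarrow> a \<in> c \<boxplus> mneg A b \<and> b \<in> mneg A a \<boxplus> c"
    and madd_mzero: "\<lbrakk>a \<in> carrier A; b \<in> carrier A\<rbrakk> \<Longrightarrow> b \<in> a \<boxplus> mzero A \<longleftrightarrow> a = b"
    and madd_assoc:
      "\<lbrakk>a \<in> carrier A; b \<in> carrier A; c \<in> carrier A\<rbrakk> \<Longrightarrow>
        (\<Union>p\<in>a \<boxplus> b. p \<boxplus> c) = (\<Union>q\<in>b \<boxplus> c. a \<boxplus> q)"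
    and madd_commute: "\<lbrakk>a \<in> carrier A; b \<in> carrier A\<rbrakk> \<Longrightarrow> a \<boxplus> b = b \<boxplus> a"
    and mult_mzero: "a \<in> carrier A \<Longrightarrow> a \<otimes> mzero A = mzero A"
    and mult_madd:
      "\<lbrakk>a \<in> carrier A; b \<in> carrier A; d \<in> carrier A; c \<in> a \<boxplus> b\<rbrakk> \<Longrightarrow>
        d \<otimes> c \<in> (d \<otimes> a) \<boxplus> (d \<otimes> b)"

locale real_reduced_multiring = comm_multiring +
  assumes one_not_mzero: "\<one> \<noteq> mzero A"
    and cube_eq: "a \<in> carrier A \<Longrightarrow> a [^] (3::nat) = a"
    and madd_mult_square:
      "\<lbrakk>a \<in> carrier A; b \<in> carrier A; c \<in> carrier A; c \<in> a \<boxplus> (a \<otimes> b [^] (2::nat))\<rbrakk> \<Longrightarrow> c = a"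
    and madd_squares_unique:
      "\<lbrakk>a \<in> carrier A; b \<in> carrier A; c \<in> carrier A; d \<in> carrier A;
        c \<in> (a [^] (2::nat)) \<boxplus> (b [^] (2::nat)); d \<in> (a [^] (2::nat)) \<boxplus> (b [^] (2::nat))\<rbrakk> \<Longrightarrow> c = d"


section \<open>Marshall quotients\<close>

definition marshall_rel :: "('a, 'm) ring_scheme \<Rightarrow> 'a set \<Rightarrow> ('a \<times> 'a) set" where
  "marshall_rel R S = {(a, b). a \<in> carrier R \<and> b \<in> carrier R \<and>
     (\<exists>s\<in>S. \<exists>t\<in>S. a \<otimes>\<^bsub>R\<^esub> s = b \<otimes>\<^bsub>R\<^esub> t)}"

abbreviation marshall_class :: "('a, 'm) ring_scheme \<Rightarrow> 'a set \<Rightarrow> 'a \<Rightarrow> 'a set" where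
  "marshall_class R S a \<equiv> marshall_rel R S `` {a}"

text \<open>
  Elements are the equivalence classes, and the operations range over all representatives. When
  \<open>S\<close> is multiplicative, the choice of representatives is immaterial: see
  \<open>marshall_mult_class\<close>, \<open>marshall_mneg_class\<close> and \<open>marshall_madd_class\<close> below.
\<close>

definition marshall_quotient :: "('a, 'm) ring_scheme \<Rightarrow> 'a set \<Rightarrow> 'a set multiring" where
  "marshall_quotient R S =
    \<lparr>carrier = carrier R // marshall_rel R S,
     mult = (\<lambda>X Y. \<Union>a\<in>X. \<Union>b\<in>Y. marshall_class R S (a \<otimes>\<^bsub>R\<^esub> b)),
     one = marshall_class R S \<one>\<^bsub>R\<^esub>,
     mzero = marshall_class R S \<zero>\<^bsub>R\<^esub>,
     mneg = (\<lambda>X. \<Union>a\<in>X. marshall_class R S (\<ominus>\<^bsub>R\<^esub> a)),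
     madd = (\<lambda>X Y. {marshall_class R S c | c. c \<in> carrier R \<and>
       (\<exists>a\<in>X. \<exists>b\<in>Y. \<exists>r\<in>S. \<exists>s\<in>S. \<exists>t\<in>S.
         c \<otimes>\<^bsub>R\<^esub> r = a \<otimes>\<^bsub>R\<^esub> s \<oplus>\<^bsub>R\<^esub> b \<otimes>\<^bsub>R\<^esub> t)})\<rparr>"

definition unit_squares :: "('a, 'm) monoid_scheme \<Rightarrow> 'a set" where
  "unit_squares R = {u [^]\<^bsub>R\<^esub> (2::nat) | u. u \<in> Units R}"

text \<open>
  \<open>ZFact (int n)\<close> is the quotient ring of the integers by the ideal generated by \<open>n\<close>;
  for \<open>n = 1\<close> it is the zero ring (unlike \<open>residue_ring 1\<close>, whose unit lies outside its carrier).
\<close>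

definition M :: "nat \<Rightarrow> int set set multiring" where
  "M n = marshall_quotient (ZFact (int n)) (unit_squares (ZFact (int n)))"


section \<open>Marshall quotients are commutative multirings\<close>

locale marshall = cring R for R (structure) +
  fixes S
  assumes S_sub: "S \<subseteq> carrier R"
    and S_one: "\<one> \<in> S"
    and S_mult: "\<lbrakk>s \<in> S; t \<in> S\<rbrakk> \<Longrightarrow> s \<otimes> t \<in> S"
begin

abbreviation Q where "Q \<equiv> marshall_quotient R S"
abbreviation cls where "cls \<equiv> marshall_class R S"

lemma S_carr [simp]: "s \<in> S \<Longrightarrow> s \<in> carrier R"
  using S_sub by blast

lemma relI: "\<lbrakk>a \<in> carrier R; b \<in> carrier R; s \<in> S; t \<in> S; a \<otimes> s = b \<otimes> t\<rbrakk> \<Longrightarrow> (a, b) \<in> marshall_rel R S"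
  unfolding marshall_rel_def by blast

lemma equiv_rel: "equiv (carrier R) (marshall_rel R S)"
proof (rule equivI)
  show "marshall_rel R S \<subseteq> carrier R \<times> carrier R"
    by (auto simp: marshall_rel_def)
  show "refl_on (carrier R) (marshall_rel R S)"
    by (rule refl_onI) (auto simp: marshall_rel_def intro: S_one)
  show "sym (marshall_rel R S)"
    by (rule symI) (auto simp: marshall_rel_def, metis)
  show "trans (marshall_rel R S)"
  proof (rule transI)
    fix a b c assume "(a, b) \<in> marshall_rel R S" "(b, c) \<in> marshall_rel R S"
    then obtain s t u v where *: "a \<in> carrier R" "b \<in> carrier R" "c \<in> carrier R"
      "s \<in> S" "t \<in> S" "u \<in> S" "v \<in> S" "a \<otimes> s = b \<otimes> t" "b \<otimes> u = c \<otimes> v"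
      unfolding marshall_rel_def by blast
    note carr = *(1-3) *(4-7)[THEN S_carr]
    have "a \<otimes> (s \<otimes> u) = (a \<otimes> s) \<otimes> u" using carr by (simp add: m_assoc)
    also have "\<dots> = (b \<otimes> u) \<otimes> t" unfolding \<open>a \<otimes> s = b \<otimes> t\<close> using carr by (simp add: m_ac)
    also have "\<dots> = c \<otimes> (v \<otimes> t)" unfolding \<open>b \<otimes> u = c \<otimes> v\<close> using carr by (simp add: m_assoc)
    finally show "(a, c) \<in> marshall_rel R S"
      using *(1-7) by (intro relI[of _ _ "s \<otimes> u" "v \<otimes> t"]) (auto intro: S_mult)
  qed
qed

lemma cls_eq_iff: "\<lbrakk>a \<in> carrier R; b \<in> carrier R\<rbrakk> \<Longrightarrow> cls a = cls b \<longleftrightarrow> (\<exists>s\<in>S. \<exists>t\<in>S. a \<otimes> s = b \<otimes> t)"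
  by (subst eq_equiv_class_iff[OF equiv_rel]) (auto simp: marshall_rel_def)

lemma cls_eqI: "\<lbrakk>a \<in> carrier R; b \<in> carrier R; s \<in> S; t \<in> S; a \<otimes> s = b \<otimes> t\<rbrakk> \<Longrightarrow> cls a = cls b"
  using cls_eq_iff by blast

lemma in_cls: "a' \<in> cls a \<longleftrightarrow> a \<in> carrier R \<and> a' \<in> carrier R \<and> (\<exists>s\<in>S. \<exists>t\<in>S. a \<otimes> s = a' \<otimes> t)"
  by (auto simp: marshall_rel_def)

lemma cls_self: "a \<in> carrier R \<Longrightarrow> a \<in> cls a"
  unfolding in_cls using S_one by blast

lemma in_Q: "X \<in> carrier Q \<longleftrightarrow> (\<exists>a\<in>carrier R. X = cls a)"
  by (auto simp: marshall_quotient_def quotient_def)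

lemma cls_closed [simp]: "a \<in> carrier R \<Longrightarrow> cls a \<in> carrier Q"
  using in_Q by blast

lemma marshall_mult_class:
  assumes "a \<in> carrier R" "b \<in> carrier R"
  shows "cls a \<otimes>\<^bsub>Q\<^esub> cls b = cls (a \<otimes> b)"
proof -
  have "cls (x \<otimes> y) = cls (a \<otimes> b)" if "x \<in> cls a" "y \<in> cls b" for x y
  proof -
    from that obtain s t u v where *: "x \<in> carrier R" "y \<in> carrier R"
      "s \<in> S" "t \<in> S" "u \<in> S" "v \<in> S" "a \<otimes> s = x \<otimes> t" "b \<otimes> u = y \<otimes> v"
      unfolding in_cls by blast
    note carr = *(1,2) *(3-6)[THEN S_carr] assms
    have "x \<otimes> y \<otimes> (t \<otimes> v) = (x \<otimes> t) \<otimes> (y \<otimes> v)" using carr by (simp add: m_ac)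
    also have "\<dots> = a \<otimes> b \<otimes> (s \<otimes> u)"
      unfolding \<open>a \<otimes> s = x \<otimes> t\<close>[symmetric] \<open>b \<otimes> u = y \<otimes> v\<close>[symmetric] using carr by (simp add: m_ac)
    finally show ?thesis
      using *(1-6) assms by (intro cls_eqI[of _ _ "t \<otimes> v" "s \<otimes> u"]) (auto intro: S_mult)
  qed
  then have "(\<Union>x\<in>cls a. \<Union>y\<in>cls b. cls (x \<otimes> y)) = (\<Union>x\<in>cls a. \<Union>y\<in>cls b. cls (a \<otimes> b))"
    by (intro SUP_cong refl) blast
  also have "\<dots> = cls (a \<otimes> b)" using cls_self assms by blast
  finally show ?thesis by (simp add: marshall_quotient_def)
qed

lemma marshall_mneg_class:
  assumes "a \<in> carrier R"
  shows "mneg Q (cls a) = cls (\<ominus> a)"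
proof -
  have "cls (\<ominus> x) = cls (\<ominus> a)" if "x \<in> cls a" for x
  proof -
    from that obtain s t where *: "x \<in> carrier R" "s \<in> S" "t \<in> S" "a \<otimes> s = x \<otimes> t"
      unfolding in_cls by blast
    then have "\<ominus> x \<otimes> t = \<ominus> a \<otimes> s" using assms by (simp add: l_minus)
    with * assms show ?thesis by (intro cls_eqI[of _ _ t s]) auto
  qed
  then have "(\<Union>x\<in>cls a. cls (\<ominus> x)) = (\<Union>x\<in>cls a. cls (\<ominus> a))"
    by (intro SUP_cong refl) blast
  also have "\<dots> = cls (\<ominus> a)" using cls_self assms by blast
  finally show ?thesis by (simp add: marshall_quotient_def)
qed

lemma madd_mem:
  assumes "a \<in> carrier R" "b \<in> carrier R" "c \<in> carrier R"
  shows "cls c \<in> cls a \<boxplus>\<^bsub>Q\<^esub> cls b \<longleftrightarrow> (\<exists>r\<in>S. \<exists>s\<in>S. \<exists>t\<in>S. c \<otimes> r = a \<otimes> s \<oplus> b \<otimes> t)" (is "?l \<longleftrightarrow> ?r")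
proof
  assume ?l
  then obtain c' x y r s t where c: "c' \<in> carrier R" "cls c = cls c'" "x \<in> cls a" "y \<in> cls b"
      "r \<in> S" "s \<in> S" "t \<in> S" "c' \<otimes> r = x \<otimes> s \<oplus> y \<otimes> t"
    by (auto simp: marshall_quotient_def)
  from c(2) obtain e f where ef: "e \<in> S" "f \<in> S" "c \<otimes> e = c' \<otimes> f"
    unfolding cls_eq_iff[OF assms(3) c(1)] by blast
  from c(3,4) obtain g h i j where g: "x \<in> carrier R" "y \<in> carrier R" "g \<in> S" "h \<in> S" "i \<in> S" "j \<in> S"
    "a \<otimes> g = x \<otimes> h" "b \<otimes> i = y \<otimes> j"
    unfolding in_cls by blast
  note S = c(5-7) ef(1,2) g(3-6)
  note carr = S[THEN S_carr] c(1) g(1,2) assms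
  have "c \<otimes> (e \<otimes> r \<otimes> h \<otimes> j) = (c \<otimes> e) \<otimes> (r \<otimes> h \<otimes> j)" using carr by (simp add: m_ac)
  also have "\<dots> = (c' \<otimes> r) \<otimes> (f \<otimes> h \<otimes> j)" unfolding ef(3) using carr by (simp add: m_ac)
  also have "\<dots> = (x \<otimes> h) \<otimes> (s \<otimes> f \<otimes> j) \<oplus> (y \<otimes> j) \<otimes> (t \<otimes> f \<otimes> h)"
    unfolding c(8) using carr by (simp add: m_ac l_distr r_distr)
  also have "\<dots> = a \<otimes> (g \<otimes> s \<otimes> f \<otimes> j) \<oplus> b \<otimes> (i \<otimes> t \<otimes> f \<otimes> h)"
    unfolding g(7,8)[symmetric] using carr by (simp add: m_ac)
  finally show ?r
    by (intro bexI[of _ "e \<otimes> r \<otimes> h \<otimes> j"] bexI[of _ "g \<otimes> s \<otimes> f \<otimes> j"]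
      bexI[of _ "i \<otimes> t \<otimes> f \<otimes> h"]) (use S in \<open>auto intro: S_mult\<close>)
next
  assume ?r
  then show ?l unfolding marshall_quotient_def multiring.simps
    using assms cls_self by blast
qed

lemma madd_memI:
  "\<lbrakk>c \<otimes> r = a \<otimes> s \<oplus> b \<otimes> t; r \<in> S; s \<in> S; t \<in> S; a \<in> carrier R; b \<in> carrier R; c \<in> carrier R\<rbrakk>
    \<Longrightarrow> cls c \<in> cls a \<boxplus>\<^bsub>Q\<^esub> cls b"
  by (subst madd_mem) blast+

lemma madd_memE:
  assumes "cls c \<in> cls a \<boxplus>\<^bsub>Q\<^esub> cls b" "a \<in> carrier R" "b \<in> carrier R" "c \<in> carrier R"
  obtains r s t where "r \<in> S" "s \<in> S" "t \<in> S" "c \<otimes> r = a \<otimes> s \<oplus> b \<otimes> t"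
  using assms(1) unfolding madd_mem[OF assms(2-4)] by blast

lemma marshall_madd_class:
  assumes "a \<in> carrier R" "b \<in> carrier R"
  shows "cls a \<boxplus>\<^bsub>Q\<^esub> cls b =
    {cls c | c. c \<in> carrier R \<and> (\<exists>r\<in>S. \<exists>s\<in>S. \<exists>t\<in>S. c \<otimes> r = a \<otimes> s \<oplus> b \<otimes> t)}"
proof -
  have "\<exists>c\<in>carrier R. X = cls c" if "X \<in> cls a \<boxplus>\<^bsub>Q\<^esub> cls b" for X
    using that by (auto simp: marshall_quotient_def)
  then have "cls a \<boxplus>\<^bsub>Q\<^esub> cls b = {cls c | c. c \<in> carrier R \<and> cls c \<in> cls a \<boxplus>\<^bsub>Q\<^esub> cls b}"
    by blast
  then show ?thesis by (simp add: madd_mem[OF assms] cong: conj_cong)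
qed

lemma one_Q: "\<one>\<^bsub>Q\<^esub> = cls \<one>" and mzero_Q: "mzero Q = cls \<zero>"
  by (simp_all add: marshall_quotient_def)

lemma madd_Q_closed: "X \<boxplus>\<^bsub>Q\<^esub> Y \<subseteq> carrier Q"
  by (auto simp: marshall_quotient_def quotient_def)

lemma madd_Q_comm:
  assumes "X \<in> carrier Q" "Y \<in> carrier Q"
  shows "X \<boxplus>\<^bsub>Q\<^esub> Y \<subseteq> Y \<boxplus>\<^bsub>Q\<^esub> X"
proof -
  from assms obtain a b where *: "a \<in> carrier R" "b \<in> carrier R" "X = cls a" "Y = cls b"
    unfolding in_Q by blast
  show ?thesis
  proof
    fix Z assume Z: "Z \<in> X \<boxplus>\<^bsub>Q\<^esub> Y"
    then obtain c where c: "c \<in> carrier R" "Z = cls c" using madd_Q_closed in_Q by blast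
    obtain r s t where rst: "r \<in> S" "s \<in> S" "t \<in> S" "c \<otimes> r = a \<otimes> s \<oplus> b \<otimes> t"
      by (rule madd_memE[OF Z[unfolded c(2) *(3,4)] *(1,2) c(1)])
    then have "c \<otimes> r = b \<otimes> t \<oplus> a \<otimes> s" using * by (simp add: a_comm)
    then show "Z \<in> Y \<boxplus>\<^bsub>Q\<^esub> X" using rst(1-3) madd_mem[OF *(2,1) c(1)] unfolding *(3,4) c by blast
  qed
qed

lemma madd_Q_assoc:
  assumes "X \<in> carrier Q" "Y \<in> carrier Q" "Z \<in> carrier Q"
  shows "(\<Union>p\<in>X \<boxplus>\<^bsub>Q\<^esub> Y. p \<boxplus>\<^bsub>Q\<^esub> Z) \<subseteq> (\<Union>q\<in>Y \<boxplus>\<^bsub>Q\<^esub> Z. X \<boxplus>\<^bsub>Q\<^esub> q)"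
proof
  fix W assume "W \<in> (\<Union>p\<in>X \<boxplus>\<^bsub>Q\<^esub> Y. p \<boxplus>\<^bsub>Q\<^esub> Z)"
  then obtain P where P: "P \<in> X \<boxplus>\<^bsub>Q\<^esub> Y" "W \<in> P \<boxplus>\<^bsub>Q\<^esub> Z" by blast
  from assms obtain x y z where xyz: "x \<in> carrier R" "y \<in> carrier R" "z \<in> carrier R"
    "X = cls x" "Y = cls y" "Z = cls z" unfolding in_Q by blast
  have "P \<in> carrier Q" "W \<in> carrier Q" using P madd_Q_closed by blast+
  then obtain p w where pw: "p \<in> carrier R" "w \<in> carrier R" "P = cls p" "W = cls w"
    unfolding in_Q by blast
  obtain r s t where 1: "r \<in> S" "s \<in> S" "t \<in> S" "p \<otimes> r = x \<otimes> s \<oplus> y \<otimes> t"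
    by (rule madd_memE[OF P(1)[unfolded xyz pw] xyz(1,2) pw(1)])
  obtain r' s' t' where 2: "r' \<in> S" "s' \<in> S" "t' \<in> S" "w \<otimes> r' = p \<otimes> s' \<oplus> z \<otimes> t'"
    by (rule madd_memE[OF P(2)[unfolded xyz pw] pw(1) xyz(3) pw(2)])
  note S = 1(1-3) 2(1-3)
  note carr = S[THEN S_carr] xyz(1-3) pw(1,2)
  define q where "q = y \<otimes> (t \<otimes> s') \<oplus> z \<otimes> (t' \<otimes> r)"
  have q: "q \<in> carrier R" unfolding q_def using carr by simp
  have "w \<otimes> (r' \<otimes> r) = (p \<otimes> s' \<oplus> z \<otimes> t') \<otimes> r"
    unfolding 2(4)[symmetric] using carr by (simp add: m_ac)
  also have "\<dots> = (p \<otimes> r) \<otimes> s' \<oplus> z \<otimes> (t' \<otimes> r)" using carr by (simp add: m_ac l_distr r_distr)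
  also have "\<dots> = x \<otimes> (s \<otimes> s') \<oplus> q \<otimes> \<one>"
    unfolding 1(4) q_def using carr by (simp add: m_ac a_ac l_distr r_distr)
  finally have "cls w \<in> X \<boxplus>\<^bsub>Q\<^esub> cls q"
    unfolding xyz by (rule madd_memI) (use carr q S S_one S_mult in simp_all)
  moreover have "q \<otimes> \<one> = y \<otimes> (t \<otimes> s') \<oplus> z \<otimes> (t' \<otimes> r)" using q q_def by simp
  then have "cls q \<in> Y \<boxplus>\<^bsub>Q\<^esub> Z"
    unfolding xyz by (rule madd_memI) (use carr q S S_one S_mult in simp_all)
  ultimately show "W \<in> (\<Union>q\<in>Y \<boxplus>\<^bsub>Q\<^esub> Z. X \<boxplus>\<^bsub>Q\<^esub> q)" unfolding pw by blast
qed

lemma madd_Q_reverse: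
  assumes "X \<in> carrier Q" "Y \<in> carrier Q" "Z \<in> X \<boxplus>\<^bsub>Q\<^esub> Y"
  shows "X \<in> Z \<boxplus>\<^bsub>Q\<^esub> mneg Q Y"
proof -
  have "Z \<in> carrier Q" using assms madd_Q_closed by blast
  then obtain x y z where xyz: "x \<in> carrier R" "y \<in> carrier R" "z \<in> carrier R"
    "X = cls x" "Y = cls y" "Z = cls z" using assms(1,2) unfolding in_Q by blast
  obtain r s t where 1: "r \<in> S" "s \<in> S" "t \<in> S" "z \<otimes> r = x \<otimes> s \<oplus> y \<otimes> t"
    by (rule madd_memE[OF assms(3)[unfolded xyz] xyz(1-3)])
  have "x \<otimes> s = z \<otimes> r \<oplus> \<ominus> y \<otimes> t"
    unfolding 1(4) using 1(1-3)[THEN S_carr] xyz(1-3) by (simp add: l_minus a_assoc r_neg)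
  then show ?thesis
    unfolding xyz(4-6) marshall_mneg_class[OF xyz(2)] by (rule madd_memI) (use xyz(1-3) 1(1-3) in simp_all)
qed

lemma mneg_Q_closed: "X \<in> carrier Q \<Longrightarrow> mneg Q X \<in> carrier Q"
  using marshall_mneg_class by (auto simp: in_Q)

lemma madd_Q_mult:
  assumes "X \<in> carrier Q" "Y \<in> carrier Q" "D \<in> carrier Q" "Z \<in> X \<boxplus>\<^bsub>Q\<^esub> Y"
  shows "D \<otimes>\<^bsub>Q\<^esub> Z \<in> (D \<otimes>\<^bsub>Q\<^esub> X) \<boxplus>\<^bsub>Q\<^esub> (D \<otimes>\<^bsub>Q\<^esub> Y)"
proof -
  have "Z \<in> carrier Q" using assms madd_Q_closed by blast
  then obtain x y z d where xyz: "x \<in> carrier R" "y \<in> carrier R" "z \<in> carrier R" "d \<in> carrier R"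
    "X = cls x" "Y = cls y" "Z = cls z" "D = cls d" using assms(1-3) unfolding in_Q by blast
  obtain r s t where 1: "r \<in> S" "s \<in> S" "t \<in> S" "z \<otimes> r = x \<otimes> s \<oplus> y \<otimes> t"
    by (rule madd_memE[OF assms(4)[unfolded xyz] xyz(1-3)])
  note carr = 1(1-3)[THEN S_carr] xyz(1-4)
  have "d \<otimes> z \<otimes> r = d \<otimes> (z \<otimes> r)" using carr by (simp add: m_assoc)
  also have "\<dots> = d \<otimes> x \<otimes> s \<oplus> d \<otimes> y \<otimes> t" unfolding 1(4) using carr by (simp add: m_assoc r_distr)
  finally show ?thesis
    unfolding xyz(5-8) marshall_mult_class[OF xyz(4,1)] marshall_mult_class[OF xyz(4,2)]
      marshall_mult_class[OF xyz(4,3)]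
    by (rule madd_memI) (use carr 1(1-3) in simp_all)
qed

lemma comm_monoid_Q: "comm_monoid Q"
proof (rule comm_monoidI)
  show "\<one>\<^bsub>Q\<^esub> \<in> carrier Q" by (simp add: one_Q)
qed (auto simp: in_Q one_Q marshall_mult_class m_ac)

lemma comm_multiring_Q: "comm_multiring Q"
proof (intro comm_multiring.intro comm_monoid_Q comm_multiring_axioms.intro)
  show "mzero Q \<in> carrier Q" by (simp add: mzero_Q)
next
  fix X assume X: "X \<in> carrier Q"
  then show "mneg Q X \<in> carrier Q" by (rule mneg_Q_closed)
  from X show "X \<otimes>\<^bsub>Q\<^esub> mzero Q = mzero Q" by (auto simp: in_Q mzero_Q marshall_mult_class)
next
  fix X Y assume XY: "X \<in> carrier Q" "Y \<in> carrier Q"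
  show "X \<boxplus>\<^bsub>Q\<^esub> Y \<subseteq> carrier Q" by (rule madd_Q_closed)
  show comm: "X \<boxplus>\<^bsub>Q\<^esub> Y = Y \<boxplus>\<^bsub>Q\<^esub> X" using madd_Q_comm XY by blast
  {
    fix Z assume Z: "Z \<in> X \<boxplus>\<^bsub>Q\<^esub> Y"
    then have Zc: "Z \<in> carrier Q" using madd_Q_closed by blast
    have "Y \<in> Z \<boxplus>\<^bsub>Q\<^esub> mneg Q X" using madd_Q_reverse XY Z comm by blast
    then have "Y \<in> mneg Q X \<boxplus>\<^bsub>Q\<^esub> Z" using madd_Q_comm[OF Zc mneg_Q_closed[OF XY(1)]] by blast
    with madd_Q_reverse[OF XY Z]
    show "X \<in> Z \<boxplus>\<^bsub>Q\<^esub> mneg Q Y \<and> Y \<in> mneg Q X \<boxplus>\<^bsub>Q\<^esub> Z" by blast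
  }
  from XY obtain a b where ab: "a \<in> carrier R" "b \<in> carrier R" "X = cls a" "Y = cls b"
    unfolding in_Q by blast
  have "b \<otimes> r = a \<otimes> s \<oplus> \<zero> \<otimes> t \<longleftrightarrow> b \<otimes> r = a \<otimes> s" if "r \<in> S" "s \<in> S" "t \<in> S" for r s t
    using that ab by simp
  then have "Y \<in> X \<boxplus>\<^bsub>Q\<^esub> mzero Q \<longleftrightarrow> (\<exists>r\<in>S. \<exists>s\<in>S. b \<otimes> r = a \<otimes> s)"
    unfolding ab mzero_Q madd_mem[OF ab(1) zero_closed ab(2)] using S_one by blast
  also have "\<dots> \<longleftrightarrow> X = Y" unfolding ab cls_eq_iff[OF ab(1,2)] by metis
  finally show "Y \<in> X \<boxplus>\<^bsub>Q\<^esub> mzero Q \<longleftrightarrow> X = Y" .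
next
  fix X Y Z assume XYZ: "X \<in> carrier Q" "Y \<in> carrier Q" "Z \<in> carrier Q"
  have comm: "A \<boxplus>\<^bsub>Q\<^esub> B = B \<boxplus>\<^bsub>Q\<^esub> A" if "A \<in> carrier Q" "B \<in> carrier Q" for A B
    using madd_Q_comm that by blast
  have "(\<Union>q\<in>Y \<boxplus>\<^bsub>Q\<^esub> Z. X \<boxplus>\<^bsub>Q\<^esub> q) = (\<Union>q\<in>Z \<boxplus>\<^bsub>Q\<^esub> Y. q \<boxplus>\<^bsub>Q\<^esub> X)"
    unfolding comm[OF XYZ(2,3)] using comm[OF XYZ(1)] madd_Q_closed by (intro SUP_cong refl) blast
  also have "\<dots> \<subseteq> (\<Union>p\<in>Y \<boxplus>\<^bsub>Q\<^esub> X. Z \<boxplus>\<^bsub>Q\<^esub> p)" by (rule madd_Q_assoc) (use XYZ in auto)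
  also have "\<dots> = (\<Union>p\<in>X \<boxplus>\<^bsub>Q\<^esub> Y. p \<boxplus>\<^bsub>Q\<^esub> Z)"
    unfolding comm[OF XYZ(1,2)] using comm[OF XYZ(3)] madd_Q_closed by (intro SUP_cong refl) blast
  finally show "(\<Union>p\<in>X \<boxplus>\<^bsub>Q\<^esub> Y. p \<boxplus>\<^bsub>Q\<^esub> Z) = (\<Union>q\<in>Y \<boxplus>\<^bsub>Q\<^esub> Z. X \<boxplus>\<^bsub>Q\<^esub> q)"
    using madd_Q_assoc[OF XYZ] by blast
next
  fix X Y D Z assume "X \<in> carrier Q" "Y \<in> carrier Q" "D \<in> carrier Q" "Z \<in> X \<boxplus>\<^bsub>Q\<^esub> Y"
  then show "D \<otimes>\<^bsub>Q\<^esub> Z \<in> (D \<otimes>\<^bsub>Q\<^esub> X) \<boxplus>\<^bsub>Q\<^esub> (D \<otimes>\<^bsub>Q\<^esub> Y)" by (rule madd_Q_mult)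
qed

end

lemma marshall_unit_squares:
  assumes "cring R"
  shows "marshall R (unit_squares R)"
proof -
  interpret cring R by fact
  show ?thesis
  proof
    show "unit_squares R \<subseteq> carrier R" by (auto simp: unit_squares_def)
    show "\<one>\<^bsub>R\<^esub> \<in> unit_squares R" unfolding unit_squares_def using nat_pow_one Units_one_closed by force
    fix s t assume "s \<in> unit_squares R" "t \<in> unit_squares R"
    then obtain u v where "u \<in> Units R" "v \<in> Units R" "s = u [^]\<^bsub>R\<^esub> (2::nat)" "t = v [^]\<^bsub>R\<^esub> (2::nat)"
      unfolding unit_squares_def by blast
    then have "s \<otimes>\<^bsub>R\<^esub> t = (u \<otimes>\<^bsub>R\<^esub> v) [^]\<^bsub>R\<^esub> (2::nat)" "u \<otimes>\<^bsub>R\<^esub> v \<in> Units R"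
      by (auto simp: nat_pow_distrib Units_closed)
    then show "s \<otimes>\<^bsub>R\<^esub> t \<in> unit_squares R" unfolding unit_squares_def by blast
  qed
qed

lemma marshall_ZFact: "marshall (ZFact (int n)) (unit_squares (ZFact (int n)))"
  by (intro marshall_unit_squares ZFact_is_cring)

lemma comm_multiring_M: "comm_multiring (M n)"
  unfolding M_def by (rule marshall.comm_multiring_Q[OF marshall_ZFact])

end

theory Submission
  imports Defs
begin

text \<open>
  Putting \<open>a = b = 1\<close> in axiom (iii) of a real reduced multiring gives \<open>1 + 1 = {1}\<close>. In a Marshall
  quotient \<open>[k + 1]\<close> always lies in \<open>[k] + [1]\<close>, so by induction every positive integer \<open>k\<close> has class
  \<open>[k] = [1]\<close>. In the Marshall quotient of \<open>\<int>/n\<int>\<close> this applies to \<open>k = n\<close> and yields \<open>[0] = [1]\<close>,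
  which axiom (i) forbids. The induction works for every commutative ring and multiplicative set, so only
  rings of characteristic zero can have a real reduced Marshall quotient.
\<close>

context marshall
begin

lemma class_pos_multiple_one:
  fixes k :: nat
  assumes "real_reduced_multiring Q" and "k > 0"
  shows "cls ([k] \<cdot> \<one>) = cls \<one>"
  using \<open>k > 0\<close>
proof (induction k rule: nat_induct_non_zero)
  case 1
  show ?case by simp
next
  case (Suc k)
  interpret Q: real_reduced_multiring Q by fact
  have "cls ([Suc k] \<cdot> \<one>) \<in> cls ([k] \<cdot> \<one>) \<boxplus>\<^bsub>Q\<^esub> cls \<one>"
    by (rule madd_memI[of _ \<one> _ \<one> _ \<one>]) (simp_all add: S_one)
  then have "cls ([Suc k] \<cdot> \<one>) \<in> \<one>\<^bsub>Q\<^esub> \<boxplus>\<^bsub>Q\<^esub> (\<one>\<^bsub>Q\<^esub> \<otimes>\<^bsub>Q\<^esub> \<one>\<^bsub>Q\<^esub> [^]\<^bsub>Q\<^esub> (2::nat))"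
    by (simp only: Suc.IH one_Q[symmetric] Q.nat_pow_one Q.l_one Q.one_closed)
  then have "cls ([Suc k] \<cdot> \<one>) = \<one>\<^bsub>Q\<^esub>"
    by (intro Q.madd_mult_square[of _ "\<one>\<^bsub>Q\<^esub>"]) simp_all
  then show ?case by (simp only: one_Q)
qed

lemma real_reduced_imp_char_0:
  fixes k :: nat
  assumes "real_reduced_multiring Q" and "k > 0"
  shows "[k] \<cdot> \<one> \<noteq> \<zero>"
proof
  assume "[k] \<cdot> \<one> = \<zero>"
  then have "\<one>\<^bsub>Q\<^esub> = mzero Q"
    using class_pos_multiple_one[OF assms] by (simp add: one_Q mzero_Q)
  with real_reduced_multiring.one_not_mzero[OF assms(1)] show False by contradiction
qed

end

text \<open>
  The integer \<open>k\<close> is carried to \<open>k \<cdot> 1\<close> by the quotient map, so the multiple \<open>n \<cdot> 1\<close> is the coset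
  of \<open>n\<close>, which lies in the ideal generated by \<open>n\<close>.
\<close>

lemma add_pow_one_ZFact:
  fixes k :: nat
  shows "[k] \<cdot>\<^bsub>ZFact m\<^esub> \<one>\<^bsub>ZFact m\<^esub> = Idl\<^bsub>\<Z>\<^esub> {m} +>\<^bsub>\<Z>\<^esub> int k"
proof -
  interpret I: ideal "Idl\<^bsub>\<Z>\<^esub> {m}" \<Z> by (rule int.genideal_ideal) simp
  interpret h: ring_hom_ring \<Z> "ZFact m" "(+>\<^bsub>\<Z>\<^esub>) (Idl\<^bsub>\<Z>\<^esub> {m})"
    unfolding ZFact_def by (rule I.rcos_ring_hom_ring)
  show ?thesis
  proof (induction k)
    case 0
    show ?case using h.hom_zero by simp
  next
    case (Suc k)
    have "Idl\<^bsub>\<Z>\<^esub> {m} +>\<^bsub>\<Z>\<^esub> (int k + 1) = (Idl\<^bsub>\<Z>\<^esub> {m} +>\<^bsub>\<Z>\<^esub> int k) \<oplus>\<^bsub>ZFact m\<^esub> \<one>\<^bsub>ZFact m\<^esub>"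
      using h.hom_add[of "int k" 1] h.hom_one by simp
    with Suc show ?case by (simp add: add.commute)
  qed
qed

lemma add_pow_one_ZFact_self:
  fixes n :: nat
  shows "[n] \<cdot>\<^bsub>ZFact (int n)\<^esub> \<one>\<^bsub>ZFact (int n)\<^esub> = \<zero>\<^bsub>ZFact (int n)\<^esub>"
proof -
  interpret I: ideal "Idl\<^bsub>\<Z>\<^esub> {int n}" \<Z> by (rule int.genideal_ideal) simp
  have "int n \<in> Idl\<^bsub>\<Z>\<^esub> {int n}" by (simp add: int.genideal_self')
  then have "Idl\<^bsub>\<Z>\<^esub> {int n} +>\<^bsub>\<Z>\<^esub> int n = Idl\<^bsub>\<Z>\<^esub> {int n}" by (rule I.a_rcos_const)
  then show ?thesis
    by (simp add: add_pow_one_ZFact) (simp add: ZFact_def FactRing_def)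
qed

theorem theorem5p9:
  shows "\<not> (\<exists>n::nat. n > 0 \<and> real_reduced_multiring (M n))"
proof
  assume "\<exists>n::nat. n > 0 \<and> real_reduced_multiring (M n)"
  then obtain n :: nat where "n > 0" and "real_reduced_multiring (M n)" by blast
  then show False
    using marshall.real_reduced_imp_char_0[OF marshall_ZFact] add_pow_one_ZFact_self
    unfolding M_def by blast
qed

end
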